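(* For all $n\ge 1$, $\mathcal B_n \subseteq \mathcal D_n$. Moreover, if each extreme ray of the cone $\log(\mathcal D_n)\subseteq\mathbb R^{(2^N)}$ represents a bounded ratio (i.e. is spanned by the formal logarithm of a bounded ratio), then $\mathcal B_n = \mathcal D_n$.
   Context: Let $N=\{1,\dots,n\}$. Matrices are complex; positive definite (PD) matrices are Hermitian. For an $n\times n$ matrix $A$ and $S\subseteq N$, $A[S]$ is the principal submatrix in rows and columns $S$, with $\det A[\emptyset]=1$. Given finitely many index sets $\alpha_1,\dots,\alpha_p\subseteq N$ and exponents $\eta_1,\dots,\eta_p>0$ put $\alpha(A)=\prod_{i=1}^p(\det A[\alpha_i])^{\eta_i}$. A ratio $\frac{\alpha}{\beta}$ is the function $A\mapsto \alpha(A)/\beta(A)$ on $n\times n$ PD matrices, for two such products $\alpha,\beta$. It is bounded if it has an upper bound independent of the PD matrix $A$; $\mathcal B_n$ is the set of bounded ratios. The formal logarithm $\log(\frac{\alpha}{\beta})\in\mathbb R^{(2^N)}$ is the vector indexed by the subsets of $N$ whose entry at a nonempty $S$ is the total exponent of $S$ in $\alpha$ minus that in $\beta$, and whose entry at $\emptyset$ is chosen so that all entries sum to $0$. Ratios are identified when they have the same formal logarithm. For a set $\mathcal X$ of ratios, $\log(\mathcal X)$ is the set of formal logarithms of its elements. A ratio is homogeneous if $\alpha(D)/\beta(D)=1$ for every PD diagonal matrix $D$. For a matrix $M$ with $n$ columns, its nullity type $\operatorname{nul}(M)\in\mathbb R^{(2^N)}$ is the vector whose entry at $T\subseteq N$ is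 the dimension of the null space of the submatrix of $M$ formed by the columns in $T$ (entry $0$ for $T=\emptyset$). There are finitely many distinct nullity types for given $n$. $\mathcal D_n$ is the set of homogeneous ratios $\frac{\alpha}{\beta}$ such that $\log(\frac{\alpha}{\beta})^T\nu\ge 0$ for every nullity type $\nu$ of a matrix with $n$ columns. *)

theory Defs
  imports "HOL-Analysis.Analysis"
begin

text \<open>
  The index set $N$ is the finite type \<open>'n\<close>, so $n$ is \<open>CARD('n)\<close>, which is at least 1 and
  otherwise arbitrary. The space $R^{(2^N)}$ is \<open>real ^ 'n set\<close>.
\<close>

section \<open>Positive definite matrices and principal minors\<close>

definition pos_def :: "complex ^ 'n ^ 'n \<Rightarrow> bool" where
  "pos_def A \<longleftrightarrow> (\<forall>i j. A $ i $ j = cnj (A $ j $ i)) \<and>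
     (\<forall>x. x \<noteq> 0 \<longrightarrow> 0 < Re (\<Sum>i\<in>UNIV. cnj (x $ i) * (A *v x) $ i))"

text \<open>
  The determinant of the principal submatrix $A[S]$, by the same formula as \<^const>\<open>det\<close> with the
  index type replaced by the index set \<open>S\<close>.
\<close>

definition minor :: "complex ^ 'n ^ 'n \<Rightarrow> 'n set \<Rightarrow> complex" where
  "minor A S = (\<Sum>p\<in>{p. p permutes S}. of_int (sign p) * (\<Prod>i\<in>S. A $ i $ p i))"

lemma minor_empty [simp]: "minor A {} = 1"
  by (simp add: minor_def)

lemma minor_UNIV: "minor A UNIV = det A"
  by (simp add: minor_def det_def)

section \<open>Ratios\<close>

text \<open>A product is the list of its pairs (index set, exponent); a ratio is the pair (numerator, denominator).\<close>

type_synonym 'n minor_product = "('n set \<times> real) list"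
type_synonym 'n ratio = "'n minor_product \<times> 'n minor_product"

definition is_product :: "'n minor_product \<Rightarrow> bool" where
  "is_product \<alpha> \<longleftrightarrow> (\<forall>(S, \<eta>) \<in> set \<alpha>. 0 < \<eta>)"

definition ratios :: "'n ratio set" where
  "ratios = {(\<alpha>, \<beta>). is_product \<alpha> \<and> is_product \<beta>}"

text \<open>
  Products are only ever evaluated at positive definite matrices, whose principal minors are
  positive reals; this is why the real part is taken.
\<close>

definition product_value :: "'n::finite minor_product \<Rightarrow> complex ^ 'n ^ 'n \<Rightarrow> real" where
  "product_value \<alpha> A = prod_list (map (\<lambda>(S, \<eta>). Re (minor A S) powr \<eta>) \<alpha>)"

definition ratio_value :: "'n::finite ratio \<Rightarrow> complex ^ 'n ^ 'n \<Rightarrow> real" where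
  "ratio_value \<rho> A = product_value (fst \<rho>) A / product_value (snd \<rho>) A"

definition bounded_ratio :: "'n::finite ratio \<Rightarrow> bool" where
  "bounded_ratio \<rho> \<longleftrightarrow> (\<exists>C. \<forall>A. pos_def A \<longrightarrow> ratio_value \<rho> A \<le> C)"

definition homogeneous_ratio :: "'n::finite ratio \<Rightarrow> bool" where
  "homogeneous_ratio \<rho> \<longleftrightarrow>
     (\<forall>D. pos_def D \<and> (\<forall>i j. i \<noteq> j \<longrightarrow> D $ i $ j = 0) \<longrightarrow> ratio_value \<rho> D = 1)"

definition total_exponent :: "'n minor_product \<Rightarrow> 'n set \<Rightarrow> real" where
  "total_exponent \<alpha> S = sum_list (map snd (filter (\<lambda>(T, \<eta>). T = S) \<alpha>))"

definition formal_log :: "'n::finite ratio \<Rightarrow> real ^ 'n set" where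
  "formal_log \<rho> = (\<chi> S.
     if S = {} then - (\<Sum>T\<in>UNIV - {{}}. total_exponent (fst \<rho>) T - total_exponent (snd \<rho>) T)
     else total_exponent (fst \<rho>) S - total_exponent (snd \<rho>) S)"

section \<open>Nullity types\<close>

text \<open>
  A matrix with columns indexed by \<open>'n\<close> is the list of its rows, so that the number of rows can
  range over all natural numbers. A vector of $C^T$ is represented by its extension by zero to
  $C^N$.
\<close>

definition null_space :: "(complex ^ 'n::finite) list \<Rightarrow> 'n set \<Rightarrow> (complex ^ 'n) set" where
  "null_space M T = {x. (\<forall>j. j \<notin> T \<longrightarrow> x $ j = 0) \<and> (\<forall>r\<in>set M. (\<Sum>j\<in>T. r $ j * x $ j) = 0)}"

text \<open>The dimension over the complex numbers is \<^term>\<open>vec.dim\<close>; \<^const>\<open>dim\<close> is the real one.\<close>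

definition nullity_type :: "(complex ^ 'n::finite) list \<Rightarrow> real ^ 'n set" where
  "nullity_type M = (\<chi> T. real (vec.dim (null_space M T)))"

lemma nullity_type_empty: "nullity_type M $ {} = 0"
proof -
  have "null_space M {} = {0}"
    by (auto simp: null_space_def vec_eq_iff)
  then show ?thesis
    by (simp add: nullity_type_def)
qed

section \<open>The sets of ratios and extreme rays\<close>

text \<open>
  These are sets of representatives. They are closed under the identification of ratios with
  equal formal logarithm, by \<open>formal_log_eq_mem_B\<close> and \<open>formal_log_eq_mem_D\<close> below, so inclusion
  and equality between them mean inclusion and equality of the sets of identified ratios.
\<close>

definition ratios_B :: "'n::finite ratio set" where
  "ratios_B = {\<rho> \<in> ratios. bounded_ratio \<rho>}"

definition ratios_D :: "'n::finite ratio set" where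
  "ratios_D = {\<rho> \<in> ratios. homogeneous_ratio \<rho> \<and> (\<forall>M. 0 \<le> formal_log \<rho> \<bullet> nullity_type M)}"

definition extreme_ray_of :: "'a::real_vector set \<Rightarrow> 'a set \<Rightarrow> bool" where
  "extreme_ray_of R C \<longleftrightarrow> R face_of C \<and> (\<exists>v. v \<noteq> 0 \<and> R = conic hull {v})"

section \<open>Equal formal logarithms give equal functions\<close>

lemma minor_real:
  assumes "pos_def (A :: complex ^ 'n ^ 'n)"
  shows "Im (minor A S) = 0"
proof -
  have herm: "cnj (A $ i $ j) = A $ j $ i" for i j
    using assms unfolding pos_def_def by metis
  have fin: "finite S" by simp
  have "cnj (minor A S) = (\<Sum>p\<in>{p. p permutes S}. of_int (sign p) * (\<Prod>i\<in>S. A $ p i $ i))"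
    by (simp add: minor_def herm)
  also have "\<dots> = (\<Sum>p\<in>{p. p permutes S}. of_int (sign (inv p)) * (\<Prod>i\<in>S. A $ inv p i $ i))"
    by (rule sum_permutations_inverse)
  also have "\<dots> = minor A S"
    unfolding minor_def
  proof (rule sum.cong[OF refl])
    fix p assume "p \<in> {p. p permutes S}"
    then have p: "p permutes S" by simp
    have "permutation p"
      using p fin by (auto simp: permutation_permutes)
    then have "sign (inv p) = sign p"
      by (rule sign_inverse)
    moreover have "(\<Prod>i\<in>S. A $ inv p i $ i) = (\<Prod>i\<in>S. A $ i $ p i)"
      using prod.permute[OF p, of "\<lambda>i. A $ inv p i $ i"] permutes_inverses(2)[OF p]
      by (simp add: o_def)
    ultimately show "of_int (sign (inv p)) * (\<Prod>i\<in>S. A $ inv p i $ i)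
        = of_int (sign p) * (\<Prod>i\<in>S. A $ i $ p i)"
      by simp
  qed
  finally have "cnj (minor A S) = minor A S" .
  then show ?thesis
    by (metis complex_cnj complex.sel(2) complex_surj equal_neg_zero)
qed

lemma minor_nonzero:
  assumes "pos_def (A :: complex ^ 'n ^ 'n)"
  shows "minor A S \<noteq> 0"
proof -
  define B :: "complex ^ 'n ^ 'n" where
    "B = (\<chi> i j. if i \<in> S \<and> j \<in> S then A $ i $ j else if i = j then 1 else 0)"
  have "det B = (\<Sum>p\<in>{p. p permutes S}. of_int (sign p) * (\<Prod>i\<in>UNIV. B $ i $ p i))"
    unfolding det_def
  proof (rule sum.mono_neutral_right)
    show "\<forall>p\<in>{p. p permutes UNIV} - {p. p permutes S}.
        of_int (sign p) * (\<Prod>i\<in>UNIV. B $ i $ p i) = 0"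
    proof
      fix p :: "'n \<Rightarrow> 'n"
      assume p: "p \<in> {p. p permutes UNIV} - {p. p permutes S}"
      then obtain i where "i \<notin> S" "p i \<noteq> i"
        unfolding permutes_def by auto
      then have "B $ i $ p i = 0"
        by (simp add: B_def)
      then have "(\<Prod>i\<in>UNIV. B $ i $ p i) = 0"
        by (meson UNIV_I finite_class.finite_UNIV prod_zero)
      then show "of_int (sign p) * (\<Prod>i\<in>UNIV. B $ i $ p i) = 0"
        by simp
    qed
  qed (auto intro: permutes_subset finite_permutations)
  also have "\<dots> = minor A S"
    unfolding minor_def
  proof (rule sum.cong[OF refl])
    fix p assume "p \<in> {p. p permutes S}"
    then have p: "p permutes S" by simp
    have "(\<Prod>i\<in>UNIV. B $ i $ p i) = (\<Prod>i\<in>S. B $ i $ p i)"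
      by (rule prod.mono_neutral_right) (use p in \<open>auto simp: B_def permutes_not_in\<close>)
    also have "\<dots> = (\<Prod>i\<in>S. A $ i $ p i)"
      by (rule prod.cong) (use p in \<open>auto simp: B_def permutes_in_image\<close>)
    finally show "of_int (sign p) * (\<Prod>i\<in>UNIV. B $ i $ p i)
        = of_int (sign p) * (\<Prod>i\<in>S. A $ i $ p i)"
      by simp
  qed
  finally have det_B: "det B = minor A S" .
  have "x = 0" if x: "B *v x = 0" for x
  proof (rule ccontr)
    assume "x \<noteq> 0"
    have outside: "x $ i = 0" if "i \<notin> S" for i
    proof -
      have "(B *v x) $ i = (\<Sum>j\<in>UNIV. if i = j then x $ j else 0)"
        by (simp only: matrix_vector_mult_def vec_lambda_beta, rule sum.cong)
          (auto simp: B_def that)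
      then show ?thesis
        using x by simp
    qed
    have inside: "(A *v x) $ i = 0" if "i \<in> S" for i
    proof -
      have "(A *v x) $ i = (B *v x) $ i"
        unfolding matrix_vector_mult_def
        using that by (auto simp: B_def outside intro!: sum.cong)
      then show ?thesis
        using x by simp
    qed
    have "cnj (x $ i) * (A *v x) $ i = 0" for i
      using outside inside by (cases "i \<in> S") auto
    then have "Re (\<Sum>i\<in>UNIV. cnj (x $ i) * (A *v x) $ i) = 0"
      by (simp only: sum.neutral_const zero_complex.sel)
    then show False
      using assms \<open>x \<noteq> 0\<close> unfolding pos_def_def by (metis less_irrefl)
  qed
  then have "invertible B"
    by (simp add: invertible_left_inverse matrix_left_invertible_ker)
  then show ?thesis
    using det_B by (simp add: invertible_det_nz)
qed

lemma product_value_eq: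
  assumes "pos_def A"
  shows "product_value \<alpha> A = exp (\<Sum>S\<in>UNIV. total_exponent \<alpha> S * ln (Re (minor A S)))"
proof (induction \<alpha>)
  case Nil
  show ?case
    by (simp add: product_value_def total_exponent_def)
next
  case (Cons a \<alpha>)
  obtain S \<eta> where a: "a = (S, \<eta>)"
    by (cases a)
  have "Re (minor A S) \<noteq> 0"
    using minor_real[OF assms] minor_nonzero[OF assms] by (auto simp: complex_eq_iff)
  then have pw: "Re (minor A S) powr \<eta> = exp (\<eta> * ln (Re (minor A S)))"
    by (simp add: powr_def)
  have "total_exponent (a # \<alpha>) T = (if T = S then \<eta> else 0) + total_exponent \<alpha> T" for T
    by (auto simp: total_exponent_def a)
  then have "(\<Sum>T\<in>UNIV. total_exponent (a # \<alpha>) T * ln (Re (minor A T)))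
      = \<eta> * ln (Re (minor A S)) + (\<Sum>T\<in>UNIV. total_exponent \<alpha> T * ln (Re (minor A T)))"
    by (simp add: distrib_right sum.distrib if_distribR flip: if_distrib cong: if_cong)
       (simp add: if_distrib[of "\<lambda>u. u * _"] cong: if_cong)
  moreover have "product_value (a # \<alpha>) A = Re (minor A S) powr \<eta> * product_value \<alpha> A"
    by (simp add: product_value_def a)
  ultimately show ?case
    using Cons pw by (simp add: exp_add)
qed

lemma ratio_value_eq:
  assumes "pos_def A"
  shows "ratio_value \<rho> A = exp (\<Sum>S\<in>UNIV. formal_log \<rho> $ S * ln (Re (minor A S)))"
proof -
  have "(\<Sum>S\<in>UNIV. formal_log \<rho> $ S * ln (Re (minor A S)))
    = (\<Sum>S\<in>UNIV. (total_exponent (fst \<rho>) S - total_exponent (snd \<rho>) S) * ln (Re (minor A S)))"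
    by (rule sum.cong) (auto simp: formal_log_def)
  then show ?thesis
    by (simp add: ratio_value_def product_value_eq[OF assms] left_diff_distrib sum_subtractf exp_diff)
qed

lemma formal_log_eq_mem_B:
  assumes "formal_log \<rho> = formal_log \<sigma>" "\<rho> \<in> ratios" "\<sigma> \<in> ratios"
  shows "\<rho> \<in> ratios_B \<longleftrightarrow> \<sigma> \<in> ratios_B"
  using assms by (simp add: ratios_B_def bounded_ratio_def ratio_value_eq)

lemma formal_log_eq_mem_D:
  assumes "formal_log \<rho> = formal_log \<sigma>" "\<rho> \<in> ratios" "\<sigma> \<in> ratios"
  shows "\<rho> \<in> ratios_D \<longleftrightarrow> \<sigma> \<in> ratios_D"
  using assms by (simp add: ratios_D_def homogeneous_ratio_def ratio_value_eq)

end

theory Submission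
  imports Defs
begin

text \<open>
  Everything rests on one description of principal minors: for positive definite \<open>A\<close>, adjoining
  an index \<open>j\<close> to \<open>S\<close> multiplies the minor by the least value of the quadratic form of \<open>A\<close> on the
  vectors that have entry 1 at \<open>j\<close> and are otherwise supported on \<open>S\<close> (\<open>minor_insert_minimum\<close>; the
  factor is the Schur complement).

  Bounded ratios lie in D. On diagonal matrices the logarithm of a ratio is linear in the logarithms
  of the diagonal entries, and a linear function that is bounded above is zero; this gives
  homogeneity. For a matrix \<open>M\<close>, consider the matrices $M^*M + tI$ as $t \to 0$. Their form is
  $|Mx|^2 + t|x|^2$, so the factor contributed by \<open>j\<close> is of exact order \<open>t\<close> if column \<open>j\<close> of \<open>M\<close> lies in
  the span of the columns in \<open>S\<close>, and of exact order 1 otherwise. These are also the cases in which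
  adjoining \<open>j\<close> raises the nullity by 1 and by 0. Hence the logarithm of the minor at \<open>S\<close> is
  $\nu_S \ln t + O(1)$, where $\nu$ is the nullity type (\<open>ln_minor_reg_gram\<close>), and the logarithm of
  the ratio is $(\log(\alpha/\beta)^T \nu) \ln t + O(1)$. It is bounded above as $t \to 0$ only if the
  coefficient is nonnegative.

  Conversely, the formal logarithms of D form a closed convex cone. It is pointed: the nullity types of
  single 0-1 rows pair with a homogeneous vector as its sums over all subsets of a given set, and
  these sums determine the vector by Moebius inversion. Adding up these nullity types gives a
  functional that is positive on the cone away from 0, and the slice on which it equals 1 is compact.
  By the Krein-Milman theorem that slice is the convex hull of its extreme points, each of which spans
  an extreme ray of the cone. The bounded exponent vectors form a convex cone, so if they contain all the
  extreme rays then they contain everything.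
\<close>

section \<open>Principal minors and the minimum of a quadratic form\<close>

definition quad_form :: "complex ^ 'n ^ 'n \<Rightarrow> complex ^ 'n \<Rightarrow> real" where
  "quad_form A x = Re (\<Sum>i\<in>UNIV. cnj (x $ i) * (A *v x) $ i)"

text \<open>
  Only permutations fixing every index outside \<open>S\<close> contribute, because a column outside \<open>S\<close> has a single
  nonzero entry. In the rows outside \<open>S\<close>, the entries in the columns of \<open>S\<close> are arbitrary; \<open>minor_insert\<close>
  needs this freedom because it replaces a column, but not the row, by a unit vector.
\<close>
lemma det_eq_minor:
  fixes C A :: "complex ^ 'n ^ 'n"
  assumes out: "\<And>i k. k \<notin> S \<Longrightarrow> C $ i $ k = (if i = k then 1 else 0)"
    and ins: "\<And>i k. i \<in> S \<Longrightarrow> k \<in> S \<Longrightarrow> C $ i $ k = A $ i $ k"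
  shows "det C = minor A S"
proof -
  have "det C = (\<Sum>p\<in>{p. p permutes S}. of_int (sign p) * (\<Prod>i\<in>UNIV. C $ i $ p i))"
    unfolding det_def
  proof (rule sum.mono_neutral_right)
    show "\<forall>p\<in>{p. p permutes UNIV} - {p. p permutes S}.
        of_int (sign p) * (\<Prod>i\<in>UNIV. C $ i $ p i) = 0"
    proof
      fix p :: "'n \<Rightarrow> 'n"
      assume p: "p \<in> {p. p permutes UNIV} - {p. p permutes S}"
      then obtain k where k: "k \<notin> S" "p k \<noteq> k"
        unfolding permutes_def by auto
      obtain i where i: "p i = k"
        using p by (metis DiffD1 mem_Collect_eq permutes_surj surjD)
      then have "C $ i $ p i = 0"
        using k by (auto simp: out)
      then have "(\<Prod>i\<in>UNIV. C $ i $ p i) = 0"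
        by (meson UNIV_I finite_class.finite_UNIV prod_zero)
      then show "of_int (sign p) * (\<Prod>i\<in>UNIV. C $ i $ p i) = 0"
        by simp
    qed
  qed (auto intro: permutes_subset finite_permutations)
  also have "\<dots> = minor A S"
    unfolding minor_def
  proof (rule sum.cong[OF refl])
    fix p assume "p \<in> {p. p permutes S}"
    then have p: "p permutes S" by simp
    have "(\<Prod>i\<in>UNIV. C $ i $ p i) = (\<Prod>i\<in>S. C $ i $ p i)"
      by (rule prod.mono_neutral_right) (use p in \<open>auto simp: out permutes_not_in\<close>)
    also have "\<dots> = (\<Prod>i\<in>S. A $ i $ p i)"
      by (rule prod.cong) (use p in \<open>auto simp: ins permutes_in_image\<close>)
    finally show "of_int (sign p) * (\<Prod>i\<in>UNIV. C $ i $ p i)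
        = of_int (sign p) * (\<Prod>i\<in>S. A $ i $ p i)"
      by simp
  qed
  finally show ?thesis .
qed

text \<open>
  Schur complementation without block matrices. If \<open>y\<close> is the column \<open>j\<close> of the inverse of \<open>A\<close> restricted
  to \<open>insert j S\<close>, then Cramer's rule identifies \<open>y $ j\<close> with the quotient of the two minors; the
  vector sought is \<open>y\<close> normalized at \<open>j\<close>.
\<close>
lemma minor_insert:
  fixes A :: "complex ^ 'n ^ 'n"
  assumes pd: "pos_def A" and j: "j \<notin> S"
  obtains x where "x $ j = 1" "\<And>i. i \<notin> insert j S \<Longrightarrow> x $ i = 0"
    "\<And>i. i \<in> S \<Longrightarrow> (A *v x) $ i = 0"
    "minor A (insert j S) = minor A S * (A *v x) $ j"
proof -
  define T where "T = insert j S"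
  define B :: "complex ^ 'n ^ 'n" where
    "B = (\<chi> i k. if i \<in> T \<and> k \<in> T then A $ i $ k else if i = k then 1 else 0)"
  have det_B: "det B = minor A T"
    by (rule det_eq_minor) (auto simp: B_def)
  have "det B \<noteq> 0"
    using minor_nonzero[OF pd] det_B by simp
  then have "invertible B"
    by (simp add: invertible_det_nz)
  then obtain B' where "B ** B' = mat 1"
    unfolding invertible_def by blast
  then have "B *v (B' *v axis j 1) = axis j 1"
    by (simp add: matrix_vector_mul_assoc)
  then obtain y where y: "B *v y = axis j 1" by blast
  have "det (\<chi> i k. if k = j then (B *v y) $ i else B $ i $ k) = y $ j * det B"
    by (rule cramer_lemma)
  moreover have "det (\<chi> i k. if k = j then (B *v y) $ i else B $ i $ k) = minor A S"
    by (rule det_eq_minor) (use j in \<open>simp_all add: y, auto simp: B_def T_def axis_def\<close>)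
  ultimately have yj: "y $ j * minor A T = minor A S"
    by (simp add: det_B)
  then have yj0: "y $ j \<noteq> 0"
    using minor_nonzero[OF pd, of S] by auto
  have supp: "y $ i = 0" if "i \<notin> T" for i
  proof -
    have "(B *v y) $ i = (\<Sum>k\<in>UNIV. if k = i then y $ k else 0)"
      unfolding matrix_vector_mult_def vec_lambda_beta
      by (rule sum.cong) (use that in \<open>auto simp: B_def\<close>)
    then show ?thesis
      using that by (auto simp: y axis_def T_def)
  qed
  have Ay: "(A *v y) $ i = (if i = j then 1 else 0)" if "i \<in> T" for i
  proof -
    have "(A *v y) $ i = (B *v y) $ i"
      unfolding matrix_vector_mult_def vec_lambda_beta
      by (rule sum.cong) (use that supp in \<open>auto simp: B_def\<close>)
    then show ?thesis
      by (simp add: y axis_def)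
  qed
  define x where "x = (1 / y $ j) *s y"
  have Ax: "(A *v x) $ i = (A *v y) $ i / y $ j" for i
    by (simp add: x_def vector_scalar_commute)
  show thesis
  proof (rule that[of x])
    show "x $ j = 1" using yj0 by (simp add: x_def)
    show "x $ i = 0" if "i \<notin> insert j S" for i
      using that supp by (simp add: x_def T_def)
    show "(A *v x) $ i = 0" if "i \<in> S" for i
      using that j by (auto simp: Ax Ay T_def)
    show "minor A (insert j S) = minor A S * (A *v x) $ j"
      using yj yj0 by (simp add: Ax Ay T_def field_simps)
  qed
qed

lemma quad_form_plus:
  fixes A :: "complex ^ 'n ^ 'n"
  assumes herm: "\<And>i j. A $ i $ j = cnj (A $ j $ i)"
  shows "quad_form A (x + z) = quad_form A x + quad_form A z
    + 2 * Re (\<Sum>i\<in>UNIV. cnj (z $ i) * (A *v x) $ i)"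
proof -
  have "(\<Sum>i\<in>UNIV. cnj (x $ i) * (A *v z) $ i) = (\<Sum>i\<in>UNIV. \<Sum>k\<in>UNIV. cnj (x $ i) * A $ i $ k * z $ k)"
    by (simp add: matrix_vector_mult_def sum_distrib_left mult.assoc)
  also have "\<dots> = (\<Sum>k\<in>UNIV. \<Sum>i\<in>UNIV. cnj (x $ i) * A $ i $ k * z $ k)"
    by (rule sum.swap)
  also have "\<dots> = cnj (\<Sum>i\<in>UNIV. cnj (z $ i) * (A *v x) $ i)"
    by (simp add: matrix_vector_mult_def sum_distrib_left mult_ac flip: herm)
  finally have "Re (\<Sum>i\<in>UNIV. cnj (x $ i) * (A *v z) $ i) = Re (\<Sum>i\<in>UNIV. cnj (z $ i) * (A *v x) $ i)"
    by simp
  then show ?thesis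
    unfolding quad_form_def
    by (simp add: matrix_vector_right_distrib distrib_left distrib_right sum.distrib del: Re_sum)
qed

definition pivot_vectors :: "'n \<Rightarrow> 'n set \<Rightarrow> (complex ^ 'n) set" where
  "pivot_vectors j S = {x. x $ j = 1 \<and> (\<forall>i. i \<notin> insert j S \<longrightarrow> x $ i = 0)}"

lemma minor_insert_minimum:
  fixes A :: "complex ^ 'n ^ 'n"
  assumes pd: "pos_def A" and j: "j \<notin> S"
  obtains x where "x \<in> pivot_vectors j S"
    "Re (minor A (insert j S)) = Re (minor A S) * quad_form A x"
    "\<forall>w\<in>pivot_vectors j S. quad_form A x \<le> quad_form A w"
proof -
  obtain x where x: "x $ j = 1" "\<And>i. i \<notin> insert j S \<Longrightarrow> x $ i = 0"
      "\<And>i. i \<in> S \<Longrightarrow> (A *v x) $ i = 0"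
    and m: "minor A (insert j S) = minor A S * (A *v x) $ j"
    using minor_insert[OF pd j] by blast
  have herm: "A $ i $ k = cnj (A $ k $ i)" for i k
    using pd unfolding pos_def_def by blast
  have "(\<Sum>i\<in>UNIV. cnj (x $ i) * (A *v x) $ i) = (\<Sum>i\<in>UNIV. if i = j then (A *v x) $ i else 0)"
  proof (rule sum.cong[OF refl])
    show "cnj (x $ i) * (A *v x) $ i = (if i = j then (A *v x) $ i else 0)" for i
      using x by (cases "i \<in> S"; cases "i = j") auto
  qed
  then have q: "quad_form A x = Re ((A *v x) $ j)"
    by (simp add: quad_form_def)
  show thesis
  proof (rule that)
    show "x \<in> pivot_vectors j S"
      using x by (auto simp: pivot_vectors_def)
    show "Re (minor A (insert j S)) = Re (minor A S) * quad_form A x"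
      by (simp add: m q minor_real[OF pd])
    show "\<forall>w\<in>pivot_vectors j S. quad_form A x \<le> quad_form A w"
    proof
      fix w assume "w \<in> pivot_vectors j S"
      then have w: "w $ j = 1" "\<And>i. i \<notin> insert j S \<Longrightarrow> w $ i = 0"
        by (auto simp: pivot_vectors_def)
      define z where "z = w - x"
      \<comment> \<open>\<open>z\<close> lives on \<open>S\<close> and \<open>A *v x\<close> vanishes there, so the cross terms disappear.\<close>
      have "cnj (z $ i) * (A *v x) $ i = 0" for i
        using x w by (cases "i \<in> S"; cases "i = j") (auto simp: z_def)
      then have "(\<Sum>i\<in>UNIV. cnj (z $ i) * (A *v x) $ i) = 0"
        by (simp only: sum.neutral_const)
      moreover have "quad_form A z \<ge> 0"
      proof (cases "z = 0")
        case False
        then show ?thesis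
          using pd unfolding pos_def_def quad_form_def by (blast intro: less_imp_le)
      qed (simp add: quad_form_def)
      ultimately have "quad_form A x \<le> quad_form A (x + z)"
        using quad_form_plus[OF herm, where x = x and z = z] by simp
      then show "quad_form A x \<le> quad_form A w"
        by (simp add: z_def)
    qed
  qed
qed

text \<open>
  Adjoining the indices one at a time builds the minor, from 1, out of values of the form at nonzero vectors.
\<close>
lemma minor_pos:
  fixes A :: "complex ^ 'n ^ 'n"
  assumes pd: "pos_def A"
  shows "0 < Re (minor A S)"
proof (induction S rule: finite_induct[OF finite])
  case (2 j S)
  obtain x where "x \<in> pivot_vectors j S"
    and m: "Re (minor A (insert j S)) = Re (minor A S) * quad_form A x"
    by (rule minor_insert_minimum[OF pd 2(2)])
  then have "x \<noteq> 0" by (auto simp: pivot_vectors_def)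
  then have "quad_form A x > 0"
    using pd unfolding pos_def_def quad_form_def by blast
  then show ?case using m 2 by simp
qed simp

section \<open>Regularized Gram matrices and nullity\<close>

text \<open>
  The matrix $M^*M + tI$, where \<open>M\<close> is freed of repeated rows; these affect no null space.
\<close>
definition reg_gram :: "(complex ^ 'n) list \<Rightarrow> real \<Rightarrow> complex ^ 'n ^ 'n" where
  "reg_gram M t = (\<chi> i k. (\<Sum>r\<in>set M. cnj (r $ i) * r $ k) + (if i = k then of_real t else 0))"

lemma reg_gram_mult:
  "(reg_gram M t *v x) $ i = (\<Sum>r\<in>set M. cnj (r $ i) * (\<Sum>k\<in>UNIV. r $ k * x $ k)) + of_real t * x $ i"
proof -
  have "(reg_gram M t *v x) $ i = (\<Sum>k\<in>UNIV. (\<Sum>r\<in>set M. cnj (r $ i) * (r $ k * x $ k))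
      + (if i = k then of_real t * x $ k else 0))"
    unfolding reg_gram_def matrix_vector_mult_def vec_lambda_beta
    by (rule sum.cong) (auto simp: sum_distrib_right distrib_right mult.assoc)
  also have "\<dots> = (\<Sum>k\<in>UNIV. \<Sum>r\<in>set M. cnj (r $ i) * (r $ k * x $ k)) + of_real t * x $ i"
    by (simp add: sum.distrib)
  also have "(\<Sum>k\<in>UNIV. \<Sum>r\<in>set M. cnj (r $ i) * (r $ k * x $ k)) =
     (\<Sum>r\<in>set M. cnj (r $ i) * (\<Sum>k\<in>UNIV. r $ k * x $ k))"
    by (subst sum.swap) (simp add: sum_distrib_left)
  finally show ?thesis .
qed

text \<open>
  As a quadratic form the matrix is $x \mapsto |Mx|^2 + t|x|^2$, which is positive for $t > 0$ and increasing
  in \<open>t\<close>.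
\<close>
lemma quad_form_reg_gram:
  "quad_form (reg_gram M t) x = (\<Sum>r\<in>set M. (cmod (\<Sum>k\<in>UNIV. r $ k * x $ k))\<^sup>2) + t * (norm x)\<^sup>2"
proof -
  define p where "p r = (\<Sum>k\<in>UNIV. r $ k * x $ k)" for r
  have "(\<Sum>i\<in>UNIV. cnj (x $ i) * (reg_gram M t *v x) $ i)
      = (\<Sum>i\<in>UNIV. \<Sum>r\<in>set M. cnj (x $ i) * (cnj (r $ i) * p r))
        + (\<Sum>i\<in>UNIV. of_real t * (x $ i * cnj (x $ i)))"
    by (simp add: reg_gram_mult p_def[symmetric] distrib_left sum.distrib sum_distrib_left mult_ac)
  also have "(\<Sum>i\<in>UNIV. \<Sum>r\<in>set M. cnj (x $ i) * (cnj (r $ i) * p r))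
      = (\<Sum>r\<in>set M. p r * cnj (\<Sum>k\<in>UNIV. r $ k * x $ k))"
    by (subst sum.swap) (simp add: sum_distrib_left mult_ac)
  finally have "(\<Sum>i\<in>UNIV. cnj (x $ i) * (reg_gram M t *v x) $ i)
      = of_real ((\<Sum>r\<in>set M. (cmod (p r))\<^sup>2) + t * (\<Sum>i\<in>UNIV. (cmod (x $ i))\<^sup>2))"
    by (simp add: p_def[symmetric] complex_norm_square[symmetric] sum_distrib_left)
  moreover have "(norm x)\<^sup>2 = (\<Sum>i\<in>UNIV. (cmod (x $ i))\<^sup>2)"
    by (simp add: norm_vec_def L2_set_def sum_nonneg)
  ultimately show ?thesis
    unfolding quad_form_def p_def by (simp only: Re_complex_of_real)
qed

lemma pos_def_reg_gram:
  assumes "t > 0"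
  shows "pos_def (reg_gram M t)"
  unfolding pos_def_def
proof (intro conjI allI impI)
  show "reg_gram M t $ i $ j = cnj (reg_gram M t $ j $ i)" for i j
    by (simp add: reg_gram_def mult.commute)
  fix x :: "complex ^ 'a" assume "x \<noteq> 0"
  then have "quad_form (reg_gram M t) x > 0"
    unfolding quad_form_reg_gram using assms
    by (intro add_nonneg_pos sum_nonneg mult_pos_pos) auto
  then show "0 < Re (\<Sum>i\<in>UNIV. cnj (x $ i) * (reg_gram M t *v x) $ i)"
    by (simp only: quad_form_def)
qed

lemma mem_null_space:
  "x \<in> null_space M T \<longleftrightarrow>
    (\<forall>i. i \<notin> T \<longrightarrow> x $ i = 0) \<and> (\<forall>r\<in>set M. (\<Sum>k\<in>UNIV. r $ k * x $ k) = 0)"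
proof -
  have "(\<Sum>k\<in>T. r $ k * x $ k) = (\<Sum>k\<in>UNIV. r $ k * x $ k)" if "\<forall>i. i \<notin> T \<longrightarrow> x $ i = 0" for r
    by (rule sum.mono_neutral_left) (use that in auto)
  then show ?thesis
    unfolding null_space_def by auto
qed

lemma subspace_null_space: "vec.subspace (null_space M T)"
proof -
  have scale: "(\<Sum>k\<in>UNIV. r $ k * (c * x $ k)) = c * (\<Sum>k\<in>UNIV. r $ k * x $ k)"
    for c :: complex and r x :: "complex ^ 'n"
    by (simp add: sum_distrib_left mult_ac)
  show ?thesis
    by (auto simp: vec.subspace_def mem_null_space distrib_left sum.distrib scale)
qed

text \<open>
  Each null vector supported on \<open>insert j S\<close> is determined modulo those supported on \<open>S\<close> by its entry at \<open>j\<close>,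
  so adjoining an index raises the nullity by at most 1.
\<close>
lemma nullity_type_insert:
  fixes M :: "(complex ^ 'n::finite) list"
  assumes j: "j \<notin> S"
  shows "nullity_type M $ insert j S =
    nullity_type M $ S + (if pivot_vectors j S \<inter> null_space M (insert j S) \<noteq> {} then 1 else 0)"
proof (cases "pivot_vectors j S \<inter> null_space M (insert j S) \<noteq> {}")
  case True
  then obtain w where w: "w \<in> null_space M (insert j S)" "w $ j = 1"
    by (auto simp: pivot_vectors_def)
  have sub: "null_space M S \<subseteq> null_space M (insert j S)"
    by (auto simp: mem_null_space)
  have "w \<notin> null_space M S"
    using w j by (auto simp: mem_null_space)
  then have notin: "w \<notin> vec.span (null_space M S)"
    using vec.span_eq_iff subspace_null_space by blast
  have "vec.span (insert w (null_space M S)) = null_space M (insert j S)"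
  proof
    show "vec.span (insert w (null_space M S)) \<subseteq> null_space M (insert j S)"
      by (rule vec.span_minimal[OF _ subspace_null_space]) (use w sub in auto)
    show "null_space M (insert j S) \<subseteq> vec.span (insert w (null_space M S))"
    proof
      fix x assume x: "x \<in> null_space M (insert j S)"
      have "x - x $ j *s w \<in> null_space M (insert j S)"
        using x w(1) by (intro vec.subspace_diff vec.subspace_scale subspace_null_space)
      moreover have "(x - x $ j *s w) $ j = 0"
        using w(2) by simp
      ultimately have "x - x $ j *s w \<in> null_space M S"
        unfolding mem_null_space by (metis insert_iff)
      then show "x \<in> vec.span (insert w (null_space M S))"
        unfolding vec.span_insert using vec.span_base by blast
    qed
  qed
  then have "vec.dim (null_space M (insert j S)) = vec.dim (insert w (null_space M S))"
    by (metis vec.dim_span)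
  also have "\<dots> = vec.dim (null_space M S) + 1"
    using notin by (simp add: vec.dim_insert)
  finally show ?thesis
    using True by (simp add: nullity_type_def)
next
  case False
  have "x $ j = 0" if x: "x \<in> null_space M (insert j S)" for x
  proof (rule ccontr)
    assume "x $ j \<noteq> 0"
    moreover have "(1 / x $ j) *s x \<in> null_space M (insert j S)"
      using x by (rule vec.subspace_scale[OF subspace_null_space])
    ultimately have "(1 / x $ j) *s x \<in> pivot_vectors j S \<inter> null_space M (insert j S)"
      by (auto simp: pivot_vectors_def mem_null_space)
    then show False
      using False by blast
  qed
  then have "null_space M (insert j S) \<subseteq> null_space M S"
    unfolding mem_null_space subset_iff by (metis insert_iff)
  then have "null_space M (insert j S) = null_space M S"
    by (auto simp: mem_null_space)
  then show ?thesis
    using False by (simp add: nullity_type_def)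
qed

text \<open>
  The squared distance from column \<open>j\<close> of \<open>M\<close> to the span of the columns in \<open>S\<close> is positive as soon as
  the column is not in the span, since subspaces of a finite-dimensional space are closed. The
  argument is run with the Gram matrix \<open>G\<close> instead of \<open>M\<close> itself, so that images stay in the space
  \<open>complex ^ 'n\<close> whatever the number of rows; the bound for \<open>G *v x\<close> is carried back to
  the form by the triangle inequality.
\<close>
lemma residual_lower_bound:
  fixes M :: "(complex ^ 'n::finite) list"
  assumes none: "pivot_vectors j S \<inter> null_space M (insert j S) = {}"
  shows "\<exists>d>0. \<forall>x\<in>pivot_vectors j S. d \<le> quad_form (reg_gram M 0) x"
proof -
  define G where "G = reg_gram M 0"
  have G_add: "G *v (x + y) = G *v x + G *v y" for x y
    by (rule matrix_vector_right_distrib)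
  have G_scale: "G *v (c *\<^sub>R x) = c *\<^sub>R (G *v x)" for c x
    by (simp add: vec_eq_iff matrix_vector_mult_def scaleR_sum_right)
  define V :: "(complex ^ 'n) set" where "V = {y. \<forall>i. i \<notin> S - {j} \<longrightarrow> y $ i = 0}"
  have "subspace ((*v) G ` V)"
  proof (rule linear_subspace_image)
    show "linear ((*v) G)" by (rule linearI) (rule G_add, rule G_scale)
    show "subspace V" by (auto simp: V_def subspace_def)
  qed
  then have "closed ((*v) G ` V)" by (rule closed_subspace)
  have le: "(cmod (\<Sum>k\<in>UNIV. r $ k * x $ k))\<^sup>2 \<le> quad_form G x" if "r \<in> set M" for r x
    unfolding G_def quad_form_reg_gram using that
    by (simp add: member_le_sum[of r "set M" "\<lambda>r. (cmod (\<Sum>k\<in>UNIV. r $ k * x $ k))\<^sup>2"])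
  define L where "L = (\<Sum>i\<in>UNIV. \<Sum>r\<in>set M. cmod (r $ i))"
  have "L \<ge> 0" by (simp add: L_def sum_nonneg)
  have q0: "quad_form G x \<ge> 0" for x
    by (simp add: G_def quad_form_reg_gram sum_nonneg)
  have norm_G: "norm (G *v x) \<le> L * sqrt (quad_form G x)" for x
  proof -
    have "norm (G *v x) \<le> (\<Sum>i\<in>UNIV. cmod ((G *v x) $ i))"
      unfolding norm_vec_def by (rule L2_set_le_sum) simp
    also have "\<dots> \<le> (\<Sum>i\<in>UNIV. \<Sum>r\<in>set M. cmod (r $ i) * sqrt (quad_form G x))"
    proof (rule sum_mono)
      fix i
      have "cmod ((G *v x) $ i) \<le> (\<Sum>r\<in>set M. cmod (cnj (r $ i) * (\<Sum>k\<in>UNIV. r $ k * x $ k)))"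
        unfolding G_def reg_gram_mult by (simp add: norm_sum)
      also have "\<dots> \<le> (\<Sum>r\<in>set M. cmod (r $ i) * sqrt (quad_form G x))"
      proof (rule sum_mono)
        fix r assume "r \<in> set M"
        then have "cmod (\<Sum>k\<in>UNIV. r $ k * x $ k) \<le> sqrt (quad_form G x)"
          using le by (simp add: real_le_rsqrt)
        then show "cmod (cnj (r $ i) * (\<Sum>k\<in>UNIV. r $ k * x $ k)) \<le> cmod (r $ i) * sqrt (quad_form G x)"
          by (simp add: norm_mult mult_left_mono)
      qed
      finally show "cmod ((G *v x) $ i) \<le> (\<Sum>r\<in>set M. cmod (r $ i) * sqrt (quad_form G x))" .
    qed
    finally show ?thesis
      by (simp add: L_def sum_distrib_right)
  qed
  have "- (G *v axis j 1) \<notin> (*v) G ` V"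
  proof
    assume "- (G *v axis j 1) \<in> (*v) G ` V"
    then obtain y where y: "y \<in> V" "G *v y = - (G *v axis j 1)" by force
    define w where "w = axis j 1 + y"
    have "G *v w = 0" using y by (simp add: w_def G_add)
    then have "quad_form G w = 0" by (simp add: quad_form_def)
    then have "(\<Sum>k\<in>UNIV. r $ k * w $ k) = 0" if "r \<in> set M" for r
      using le[OF that, of w] by simp
    moreover have "w $ i = 0" if "i \<notin> insert j S" for i
      using that y(1) by (auto simp: w_def V_def axis_def)
    moreover have "w $ j = 1"
      using y(1) by (auto simp: w_def V_def axis_def)
    ultimately show False
      using none by (auto simp: mem_null_space pivot_vectors_def)
  qed
  then obtain e where e: "e > 0" "\<forall>z\<in>(*v) G ` V. e \<le> dist (- (G *v axis j 1)) z"
    using separate_point_closed[OF \<open>closed ((*v) G ` V)\<close>] by blast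
  have eG: "e \<le> norm (G *v x)" if x: "x \<in> pivot_vectors j S" for x
  proof -
    have "x - axis j 1 \<in> V"
      using x by (auto simp: V_def axis_def pivot_vectors_def)
    then have "e \<le> dist (- (G *v axis j 1)) (G *v (x - axis j 1))"
      using e by blast
    also have "\<dots> = norm (G *v axis j 1 + G *v (x - axis j 1))"
      by (metis dist_norm minus_diff_eq norm_minus_cancel diff_minus_eq_add add.commute)
    also have "\<dots> = norm (G *v x)"
      by (simp flip: G_add)
    finally show ?thesis .
  qed
  show ?thesis
  proof (intro exI[of _ "(e / (L + 1))\<^sup>2"] conjI ballI)
    show "0 < (e / (L + 1))\<^sup>2"
      using \<open>L \<ge> 0\<close> \<open>e > 0\<close> by auto
    fix x :: "complex ^ 'n"
    assume x: "x \<in> pivot_vectors j S"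
    have "e \<le> (L + 1) * sqrt (quad_form G x)"
      using eG[OF x] norm_G[of x] q0[of x] by (simp add: distrib_right) (smt (verit) real_sqrt_ge_zero)
    then have "e / (L + 1) \<le> sqrt (quad_form G x)"
      using \<open>L \<ge> 0\<close> by (simp add: field_simps)
    then have "(e / (L + 1))\<^sup>2 \<le> (sqrt (quad_form G x))\<^sup>2"
      using \<open>L \<ge> 0\<close> \<open>e > 0\<close> by (intro power_mono) auto
    then show "(e / (L + 1))\<^sup>2 \<le> quad_form (reg_gram M 0) x"
      using q0[of x] by (simp add: G_def)
  qed
qed

text \<open>
  The minor at \<open>S\<close> has exact order $t^{\nu_S}$. By induction on \<open>S\<close>: the factor contributed by a new index
  is the minimum of $|Mx|^2 + t|x|^2$, which lies between \<open>t\<close> and a multiple of \<open>t\<close> if some admissible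
  \<open>x\<close> is annihilated by \<open>M\<close>, and otherwise between two positive constants.
\<close>
lemma ln_minor_reg_gram:
  fixes M :: "(complex ^ 'n::finite) list"
  shows "\<exists>K. \<forall>t. 0 < t \<and> t \<le> 1 \<longrightarrow>
    \<bar>ln (Re (minor (reg_gram M t) S)) - nullity_type M $ S * ln t\<bar> \<le> K"
proof (induction S rule: finite_induct[OF finite])
  case 1
  show ?case by (auto simp: nullity_type_empty)
next
  case (2 j S)
  from 2(3) obtain K where K: "\<And>t. 0 < t \<Longrightarrow> t \<le> 1 \<Longrightarrow>
      \<bar>ln (Re (minor (reg_gram M t) S)) - nullity_type M $ S * ln t\<bar> \<le> K"
    by blast
  define m where "m = (if pivot_vectors j S \<inter> null_space M (insert j S) \<noteq> {} then 1 else 0 :: real)"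
  have "\<exists>K'. \<forall>t. \<forall>x\<in>pivot_vectors j S. 0 < t \<longrightarrow> t \<le> 1 \<longrightarrow>
      (\<forall>w\<in>pivot_vectors j S. quad_form (reg_gram M t) x \<le> quad_form (reg_gram M t) w) \<longrightarrow>
      \<bar>ln (quad_form (reg_gram M t) x) - m * ln t\<bar> \<le> K'"
  proof (cases "pivot_vectors j S \<inter> null_space M (insert j S) \<noteq> {}")
    case True
    then obtain w where w: "w \<in> pivot_vectors j S" "w \<in> null_space M (insert j S)" by blast
    show ?thesis
    proof (intro exI allI ballI impI)
      fix t :: real and x :: "complex ^ 'n"
      assume t: "0 < t" "t \<le> 1" and x: "x \<in> pivot_vectors j S"
        and min: "\<forall>w\<in>pivot_vectors j S.
          quad_form (reg_gram M t) x \<le> quad_form (reg_gram M t) w"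
      let ?q = "quad_form (reg_gram M t) x"
      \<comment> \<open>Below by \<open>t\<close> because \<open>x $ j = 1\<close>; above by comparison with the null vector \<open>w\<close>.\<close>
      have "1 \<le> (norm x)\<^sup>2"
        using Finite_Cartesian_Product.norm_nth_le[of x j] x by (simp add: pivot_vectors_def one_le_power)
      then have "t * 1 \<le> t * (norm x)\<^sup>2"
        using t by (intro mult_left_mono) auto
      also have "\<dots> \<le> ?q"
        by (simp add: quad_form_reg_gram sum_nonneg)
      finally have lo: "t \<le> ?q" by simp
      have "?q \<le> quad_form (reg_gram M t) w"
        using min w by blast
      also have "\<dots> = t * (norm w)\<^sup>2"
        using w by (simp add: quad_form_reg_gram mem_null_space)
      finally have up: "?q \<le> t * (norm w)\<^sup>2" .
      have "w \<noteq> 0" using w(1) by (auto simp: pivot_vectors_def)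
      then have "ln (t * (norm w)\<^sup>2) = ln t + ln ((norm w)\<^sup>2)"
        using t by (simp add: ln_mult)
      moreover have "ln t \<le> ln ?q" "ln ?q \<le> ln (t * (norm w)\<^sup>2)"
        using t lo up by auto
      ultimately show "\<bar>ln ?q - m * ln t\<bar> \<le> ln ((norm w)\<^sup>2)"
        using True by (simp add: m_def)
    qed
  next
    case False
    then obtain d where d: "0 < d" "\<forall>x\<in>pivot_vectors j S. d \<le> quad_form (reg_gram M 0) x"
      using residual_lower_bound by blast
    show ?thesis
    proof (intro exI allI ballI impI)
      fix t :: real and x :: "complex ^ 'n"
      assume t: "0 < t" "t \<le> 1" and x: "x \<in> pivot_vectors j S"
        and min: "\<forall>w\<in>pivot_vectors j S.
          quad_form (reg_gram M t) x \<le> quad_form (reg_gram M t) w"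
      let ?q = "quad_form (reg_gram M t) x"
      \<comment> \<open>Below by the value at \<open>t = 0\<close>; above by the unit vector at \<open>j\<close>, with \<open>t\<close> replaced by 1.\<close>
      have "d \<le> quad_form (reg_gram M 0) x"
        using d(2) x by blast
      also have "\<dots> \<le> ?q"
        using t by (simp add: quad_form_reg_gram)
      finally have lo: "d \<le> ?q" .
      have "?q \<le> quad_form (reg_gram M t) (axis j 1)"
        using min by (auto simp: pivot_vectors_def axis_def)
      also have "\<dots> \<le> quad_form (reg_gram M 1) (axis j 1)"
        using t by (simp add: quad_form_reg_gram)
      finally have up: "?q \<le> quad_form (reg_gram M 1) (axis j 1)" .
      have "ln d \<le> ln ?q" "ln ?q \<le> ln (quad_form (reg_gram M 1) (axis j 1))"
        using d(1) lo up by auto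
      then show "\<bar>ln ?q - m * ln t\<bar> \<le> \<bar>ln d\<bar> + \<bar>ln (quad_form (reg_gram M 1) (axis j 1))\<bar>"
        using False by (simp add: m_def)
    qed
  qed
  then obtain K' where K': "\<forall>t. \<forall>x\<in>pivot_vectors j S. 0 < t \<longrightarrow> t \<le> 1 \<longrightarrow>
      (\<forall>w\<in>pivot_vectors j S. quad_form (reg_gram M t) x \<le> quad_form (reg_gram M t) w) \<longrightarrow>
      \<bar>ln (quad_form (reg_gram M t) x) - m * ln t\<bar> \<le> K'" ..
  show ?case
  proof (intro exI allI impI, elim conjE)
    fix t :: real assume t: "0 < t" "t \<le> 1"
    have pd: "pos_def (reg_gram M t)" using t by (intro pos_def_reg_gram)
    obtain x where x: "x \<in> pivot_vectors j S"
      and eq: "Re (minor (reg_gram M t) (insert j S)) = Re (minor (reg_gram M t) S) * quad_form (reg_gram M t) x"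
      and min: "\<forall>w\<in>pivot_vectors j S. quad_form (reg_gram M t) x \<le> quad_form (reg_gram M t) w"
      by (rule minor_insert_minimum[OF pd 2(2)])
    have "\<bar>ln (quad_form (reg_gram M t) x) - m * ln t\<bar> \<le> K'"
      using t x min K' by blast
    moreover have "0 < quad_form (reg_gram M t) x"
      using eq minor_pos[OF pd, of S] minor_pos[OF pd, of "insert j S"] by (simp add: zero_less_mult_iff)
    then have "ln (Re (minor (reg_gram M t) (insert j S)))
        = ln (Re (minor (reg_gram M t) S)) + ln (quad_form (reg_gram M t) x)"
      using minor_pos[OF pd, of S] by (simp add: eq ln_mult)
    moreover have "nullity_type M $ insert j S = nullity_type M $ S + m"
      unfolding m_def using 2(2) by (rule nullity_type_insert)
    ultimately show "\<bar>ln (Re (minor (reg_gram M t) (insert j S))) - nullity_type M $ insert j S * ln t\<bar> \<le> K + K'"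
      using K[OF t] by (simp add: distrib_right)
  qed
qed

section \<open>Ratios as linear functionals of their exponents\<close>

text \<open>
  Boundedness of a ratio depends only on its formal logarithm, and is most easily handled for arbitrary
  exponent vectors, where it is a condition on a linear functional of the exponents.
\<close>
definition log_value :: "real ^ 'n set \<Rightarrow> complex ^ 'n::finite ^ 'n \<Rightarrow> real" where
  "log_value v A = (\<Sum>S\<in>UNIV. v $ S * ln (Re (minor A S)))"

definition bounded_exponents :: "(real ^ 'n::finite set) set" where
  "bounded_exponents = {v. \<exists>C. \<forall>A. pos_def A \<longrightarrow> log_value v A \<le> C}"

text \<open>
  The degree in the \<open>i\<close>-th diagonal entry of the value of the ratio on diagonal matrices.
\<close>
definition degree_in :: "'n \<Rightarrow> real ^ 'n::finite set \<Rightarrow> real" where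
  "degree_in i v = (\<Sum>S | i \<in> S. v $ S)"

lemma ratio_value_log_value:
  "pos_def A \<Longrightarrow> ratio_value \<rho> A = exp (log_value (formal_log \<rho>) A)"
  by (simp add: ratio_value_eq log_value_def)

lemma bounded_ratio_iff: "bounded_ratio \<rho> \<longleftrightarrow> formal_log \<rho> \<in> bounded_exponents"
proof
  assume "bounded_ratio \<rho>"
  then obtain C where C: "\<And>A. pos_def A \<Longrightarrow> exp (log_value (formal_log \<rho>) A) \<le> C"
    by (auto simp: bounded_ratio_def ratio_value_log_value)
  have "log_value (formal_log \<rho>) A \<le> ln C" if "pos_def A" for A
    using C[OF that] by (metis exp_gt_zero exp_le_cancel_iff exp_ln order_less_le_trans)
  then show "formal_log \<rho> \<in> bounded_exponents"
    unfolding bounded_exponents_def by blast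
next
  assume "formal_log \<rho> \<in> bounded_exponents"
  then obtain C where "\<And>A. pos_def A \<Longrightarrow> log_value (formal_log \<rho>) A \<le> C"
    unfolding bounded_exponents_def by blast
  then have "\<forall>A. pos_def A \<longrightarrow> ratio_value \<rho> A \<le> exp C"
    by (simp add: ratio_value_log_value)
  then show "bounded_ratio \<rho>"
    unfolding bounded_ratio_def by blast
qed

lemma log_value_add: "log_value (v + w) A = log_value v A + log_value w A"
  by (simp add: log_value_def distrib_right sum.distrib)

lemma log_value_scaleR: "log_value (c *\<^sub>R v) A = c * log_value v A"
  by (simp add: log_value_def sum_distrib_left mult.assoc)

lemma convex_cone_bounded_exponents: "convex_cone (bounded_exponents :: (real ^ 'n::finite set) set)"
  unfolding convex_cone_iff
proof (intro conjI ballI allI impI)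
  show "(0 :: real ^ 'n set) \<in> bounded_exponents"
    by (auto simp: bounded_exponents_def log_value_def)
  fix v w :: "real ^ 'n set"
  assume "v \<in> bounded_exponents" "w \<in> bounded_exponents"
  then obtain C D where "\<And>A. pos_def A \<Longrightarrow> log_value v A \<le> C" "\<And>A. pos_def A \<Longrightarrow> log_value w A \<le> D"
    unfolding bounded_exponents_def by blast
  then have "\<forall>A. pos_def A \<longrightarrow> log_value (v + w) A \<le> C + D"
    by (simp add: log_value_add add_mono)
  then show "v + w \<in> bounded_exponents"
    unfolding bounded_exponents_def by blast
next
  fix v :: "real ^ 'n set" and c :: real
  assume "v \<in> bounded_exponents" "0 \<le> c"
  then obtain C where "\<And>A. pos_def A \<Longrightarrow> log_value v A \<le> C"
    unfolding bounded_exponents_def by blast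
  then have "\<forall>A. pos_def A \<longrightarrow> log_value (c *\<^sub>R v) A \<le> c * C"
    using \<open>0 \<le> c\<close> by (simp add: log_value_scaleR mult_left_mono)
  then show "c *\<^sub>R v \<in> bounded_exponents"
    unfolding bounded_exponents_def by blast
qed

section \<open>Homogeneity and diagonal matrices\<close>

lemma minor_diagonal:
  fixes D :: "complex ^ 'n ^ 'n"
  assumes diag: "\<forall>i j. i \<noteq> j \<longrightarrow> D $ i $ j = 0"
  shows "minor D S = (\<Prod>i\<in>S. D $ i $ i)"
proof -
  define C :: "complex ^ 'n ^ 'n" where
    "C = (\<chi> i k. if i = k then if i \<in> S then D $ i $ i else 1 else 0)"
  have "minor D S = det C"
    by (rule det_eq_minor[symmetric]) (use diag in \<open>auto simp: C_def\<close>)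
  also have "\<dots> = (\<Prod>i\<in>UNIV. C $ i $ i)"
    by (rule det_diagonal) (simp add: C_def)
  also have "\<dots> = (\<Prod>i\<in>S. D $ i $ i)"
    by (simp add: C_def flip: prod.inter_filter)
  finally show ?thesis .
qed

lemma log_value_diagonal:
  fixes D :: "complex ^ 'n ^ 'n"
  assumes pd: "pos_def D" and diag: "\<forall>i j. i \<noteq> j \<longrightarrow> D $ i $ j = 0"
  shows "log_value v D = (\<Sum>i\<in>UNIV. degree_in i v * ln (Re (D $ i $ i)))"
proof -
  have pos: "0 < Re (D $ i $ i)" and real: "D $ i $ i = of_real (Re (D $ i $ i))" for i
    using minor_pos[OF pd, of "{i}"] minor_real[OF pd, of "{i}"]
    by (simp_all add: minor_diagonal[OF diag] complex_eq_iff)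
  have "minor D S = of_real (\<Prod>i\<in>S. Re (D $ i $ i))" for S
    unfolding minor_diagonal[OF diag] of_real_prod using real by (intro prod.cong) auto
  then have "Re (minor D S) = (\<Prod>i\<in>S. Re (D $ i $ i))" for S
    by (simp only: Re_complex_of_real)
  then have "ln (Re (minor D S)) = (\<Sum>i\<in>S. ln (Re (D $ i $ i)))" for S
    using pos by (simp add: ln_prod less_imp_neq[THEN not_sym])
  then have "log_value v D = (\<Sum>S\<in>UNIV. \<Sum>i\<in>S. v $ S * ln (Re (D $ i $ i)))"
    by (simp add: log_value_def sum_distrib_left)
  also have "\<dots> = (\<Sum>S\<in>UNIV. \<Sum>i\<in>UNIV. if i \<in> S then v $ S * ln (Re (D $ i $ i)) else 0)"
    by (simp flip: sum.inter_filter)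
  also have "\<dots> = (\<Sum>i\<in>UNIV. \<Sum>S\<in>UNIV. if i \<in> S then v $ S * ln (Re (D $ i $ i)) else 0)"
    by (rule sum.swap)
  also have "\<dots> = (\<Sum>i\<in>UNIV. degree_in i v * ln (Re (D $ i $ i)))"
    by (simp add: degree_in_def sum_distrib_right flip: sum.inter_filter)
  finally show ?thesis .
qed

text \<open>
  A diagonal matrix with one entry $e^s$ and all others 1 isolates the degree in that entry; letting \<open>s\<close>
  range over the reals shows that this degree must vanish for a bounded ratio.
\<close>
lemma log_value_scaled_coordinate:
  fixes v :: "real ^ 'n::finite set"
  obtains D :: "complex ^ 'n ^ 'n" where "pos_def D" "\<forall>i j. i \<noteq> j \<longrightarrow> D $ i $ j = 0"
    "log_value v D = s * degree_in k v"
proof -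
  define d where "d i = exp (if i = k then s else 0)" for i
  define D :: "complex ^ 'n ^ 'n" where "D = (\<chi> i j. if i = j then of_real (d i) else 0)"
  have diag: "\<forall>i j. i \<noteq> j \<longrightarrow> D $ i $ j = 0" by (simp add: D_def)
  have pd: "pos_def D"
    unfolding pos_def_def
  proof (intro conjI allI impI)
    fix x :: "complex ^ 'n" assume "x \<noteq> 0"
    then obtain l where l: "x $ l \<noteq> 0" by (auto simp: vec_eq_iff)
    have "(D *v x) $ i = of_real (d i) * x $ i" for i
    proof -
      have "(D *v x) $ i = (\<Sum>j\<in>UNIV. if i = j then of_real (d i) * x $ j else 0)"
        unfolding matrix_vector_mult_def vec_lambda_beta by (rule sum.cong) (auto simp: D_def)
      then show ?thesis by simp
    qed
    then have "Re (\<Sum>i\<in>UNIV. cnj (x $ i) * (D *v x) $ i) = (\<Sum>i\<in>UNIV. d i * (cmod (x $ i))\<^sup>2)"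
      by (simp add: cmod_power2) (simp add: power2_eq_square algebra_simps)
    also have "\<dots> > 0"
      by (rule sum_pos2[of _ l]) (use l in \<open>auto simp: d_def\<close>)
    finally show "0 < Re (\<Sum>i\<in>UNIV. cnj (x $ i) * (D *v x) $ i)" .
  qed (auto simp: D_def)
  have "log_value v D = (\<Sum>i\<in>UNIV. if i = k then degree_in i v * s else 0)"
    unfolding log_value_diagonal[OF pd diag] by (rule sum.cong) (auto simp: D_def d_def)
  then show thesis
    using that[OF pd diag] by simp
qed

lemma homogeneous_ratio_iff: "homogeneous_ratio \<rho> \<longleftrightarrow> (\<forall>i. degree_in i (formal_log \<rho>) = 0)"
proof
  assume h: "homogeneous_ratio \<rho>"
  show "\<forall>i. degree_in i (formal_log \<rho>) = 0"
  proof
    fix i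
    obtain D where D: "pos_def D" "\<forall>i j. i \<noteq> j \<longrightarrow> D $ i $ j = 0"
      "log_value (formal_log \<rho>) D = 1 * degree_in i (formal_log \<rho>)"
      by (rule log_value_scaled_coordinate)
    then show "degree_in i (formal_log \<rho>) = 0"
      using h by (simp add: homogeneous_ratio_def ratio_value_log_value)
  qed
next
  assume "\<forall>i. degree_in i (formal_log \<rho>) = 0"
  then show "homogeneous_ratio \<rho>"
    by (simp add: homogeneous_ratio_def ratio_value_log_value log_value_diagonal)
qed

lemma bounded_exponents_degree:
  assumes "v \<in> bounded_exponents"
  shows "degree_in i v = 0"
proof (rule ccontr)
  assume nz: "degree_in i v \<noteq> 0"
  obtain C where C: "\<And>A. pos_def A \<Longrightarrow> log_value v A \<le> C"
    using assms unfolding bounded_exponents_def by blast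
  \<comment> \<open>This scaling makes the value exceed the bound by 1, whatever the sign of the degree.\<close>
  obtain D where "pos_def D" "log_value v D = ((C + 1) / degree_in i v) * degree_in i v"
    by (rule log_value_scaled_coordinate)
  then show False
    using C[of D] nz by simp
qed

section \<open>Bounded ratios pair nonnegatively with nullity types\<close>

text \<open>
  Along the matrices $M^*M + tI$ the logarithm of the ratio is the pairing times $\ln t$, up to a bounded
  error; a negative pairing would send it to infinity as $t \to 0$.
\<close>
lemma bounded_exponents_nullity:
  assumes "v \<in> bounded_exponents"
  shows "0 \<le> v \<bullet> nullity_type M"
proof (rule ccontr)
  assume "\<not> 0 \<le> v \<bullet> nullity_type M"
  then have neg: "v \<bullet> nullity_type M < 0" by simp
  obtain C where C: "\<And>A. pos_def A \<Longrightarrow> log_value v A \<le> C"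
    using assms unfolding bounded_exponents_def by blast
  obtain K where K: "\<And>S t. 0 < t \<Longrightarrow> t \<le> 1 \<Longrightarrow>
      \<bar>ln (Re (minor (reg_gram M t) S)) - nullity_type M $ S * ln t\<bar> \<le> K S"
    using ln_minor_reg_gram[of M] by metis
  define E where "E = (\<Sum>S\<in>UNIV. \<bar>v $ S\<bar> * K S)"
  have bound: "(v \<bullet> nullity_type M) * ln t \<le> C + E" if t: "0 < t" "t \<le> 1" for t
  proof -
    have "(v \<bullet> nullity_type M) * ln t - log_value v (reg_gram M t)
        = (\<Sum>S\<in>UNIV. v $ S * (nullity_type M $ S * ln t - ln (Re (minor (reg_gram M t) S))))"
      by (simp add: inner_vec_def log_value_def sum_distrib_right right_diff_distrib sum_subtractf mult.assoc)
    also have "\<dots> \<le> E"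
      unfolding E_def
    proof (rule sum_mono)
      fix S
      have "v $ S * (nullity_type M $ S * ln t - ln (Re (minor (reg_gram M t) S)))
          \<le> \<bar>v $ S\<bar> * \<bar>ln (Re (minor (reg_gram M t) S)) - nullity_type M $ S * ln t\<bar>"
        by (metis abs_ge_self abs_minus_commute abs_mult)
      also have "\<dots> \<le> \<bar>v $ S\<bar> * K S"
        using K[OF t] by (rule mult_left_mono) simp
      finally show "v $ S * (nullity_type M $ S * ln t - ln (Re (minor (reg_gram M t) S))) \<le> \<bar>v $ S\<bar> * K S" .
    qed
    finally show ?thesis
      using C[OF pos_def_reg_gram[OF t(1)]] by (smt (verit))
  qed
  define s where "s = (\<bar>C + E\<bar> + 1) / (v \<bullet> nullity_type M)"
  have "s \<le> 0" using neg by (simp add: s_def divide_nonneg_neg)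
  then have "(v \<bullet> nullity_type M) * ln (exp s) \<le> C + E"
    by (intro bound) auto
  moreover have "(v \<bullet> nullity_type M) * ln (exp s) = \<bar>C + E\<bar> + 1"
    using neg by (simp add: s_def)
  ultimately show False by linarith
qed

section \<open>The cone of formal logarithms of D\<close>

lemma sum_formal_log: "(\<Sum>S\<in>UNIV. formal_log \<rho> $ S) = 0"
proof -
  have "(\<Sum>S\<in>UNIV. formal_log \<rho> $ S) = formal_log \<rho> $ {} + (\<Sum>S\<in>UNIV - {{}}. formal_log \<rho> $ S)"
    by (rule sum.remove) auto
  also have "(\<Sum>S\<in>UNIV - {{}}. formal_log \<rho> $ S)
      = (\<Sum>T\<in>UNIV - {{}}. total_exponent (fst \<rho>) T - total_exponent (snd \<rho>) T)"
    by (rule sum.cong) (auto simp: formal_log_def)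
  finally show ?thesis
    by (simp add: formal_log_def)
qed

lemma total_exponent_map:
  "distinct xs \<Longrightarrow> total_exponent (map (\<lambda>S. (S, f S)) xs) T = (if T \<in> set xs then f T else 0)"
  by (induction xs) (auto simp: total_exponent_def)

text \<open>
  Positive coordinates go to the numerator and negative ones to the denominator. The coordinate at the empty
  set is recovered from the vanishing of the sum.
\<close>
lemma formal_log_surj:
  fixes v :: "real ^ 'n::finite set"
  assumes sum: "(\<Sum>S\<in>UNIV. v $ S) = 0"
  obtains \<rho> where "\<rho> \<in> ratios" "formal_log \<rho> = v"
proof -
  obtain xs where xs: "set xs = UNIV - {{} :: 'n set}" "distinct xs"
    using finite_distinct_list[of "UNIV - {{} :: 'n set}"] by auto
  define \<alpha> where "\<alpha> = map (\<lambda>S. (S, v $ S)) (filter (\<lambda>S. v $ S > 0) xs)"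
  define \<beta> where "\<beta> = map (\<lambda>S. (S, - v $ S)) (filter (\<lambda>S. v $ S < 0) xs)"
  have te: "total_exponent \<alpha> S - total_exponent \<beta> S = v $ S" if "S \<noteq> {}" for S
    using that xs by (simp add: \<alpha>_def \<beta>_def total_exponent_map)
  have "(\<Sum>S\<in>UNIV. v $ S) = v $ {} + (\<Sum>S\<in>UNIV - {{}}. v $ S)"
    by (rule sum.remove) auto
  also have "(\<Sum>S\<in>UNIV - {{}}. v $ S) = (\<Sum>S\<in>UNIV - {{}}. total_exponent \<alpha> S - total_exponent \<beta> S)"
    by (rule sum.cong) (auto simp: te)
  finally have v0: "v $ {} = - (\<Sum>S\<in>UNIV - {{}}. total_exponent \<alpha> S - total_exponent \<beta> S)"
    using sum by linarith
  have "formal_log (\<alpha>, \<beta>) $ S = v $ S" for S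
  proof (cases "S = {}")
    case True
    show ?thesis
      unfolding True v0 by (simp add: formal_log_def)
  next
    case False
    then show ?thesis
      using te[OF False] by (simp add: formal_log_def)
  qed
  then have "formal_log (\<alpha>, \<beta>) = v"
    by (simp add: vec_eq_iff)
  moreover have "(\<alpha>, \<beta>) \<in> ratios"
    by (auto simp: ratios_def is_product_def \<alpha>_def \<beta>_def)
  ultimately show thesis using that by blast
qed

text \<open>
  All conditions defining D are linear in the formal logarithm. Hence its image is an intersection of hyperplanes
  and closed half-spaces through 0, which makes it a closed convex cone.
\<close>
lemma formal_log_ratios_D:
  "formal_log ` ratios_D = {v. (\<Sum>S\<in>UNIV. v $ S) = 0 \<and> (\<forall>i. degree_in i v = 0) \<and>
    (\<forall>M. 0 \<le> v \<bullet> nullity_type M)}" (is "_ = ?R")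
proof
  show "formal_log ` ratios_D \<subseteq> ?R"
    by (auto simp: ratios_D_def sum_formal_log homogeneous_ratio_iff)
  show "?R \<subseteq> formal_log ` ratios_D"
  proof
    fix v assume v: "v \<in> ?R"
    then obtain \<rho> where "\<rho> \<in> ratios" "formal_log \<rho> = v"
      using formal_log_surj by blast
    then show "v \<in> formal_log ` ratios_D"
      using v by (auto simp: ratios_D_def homogeneous_ratio_iff intro!: image_eqI[of _ _ \<rho>])
  qed
qed

lemma convex_cone_log_D: "convex_cone (formal_log ` (ratios_D :: 'n::finite ratio set))"
  unfolding convex_cone_iff formal_log_ratios_D
proof (intro conjI ballI allI impI)
  have sum_scale: "(\<Sum>S\<in>X. (c *\<^sub>R v) $ S) = c * (\<Sum>S\<in>X. v $ S)"
    for c X and v :: "real ^ 'n set"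
    by (simp add: sum_distrib_left)
  let ?D = "{v :: real ^ 'n set. (\<Sum>S\<in>UNIV. v $ S) = 0 \<and> (\<forall>i. degree_in i v = 0) \<and>
    (\<forall>M. 0 \<le> v \<bullet> nullity_type M)}"
  show "0 \<in> ?D"
    by (simp add: degree_in_def)
  show "v + w \<in> ?D" if "v \<in> ?D" "w \<in> ?D" for v w
    using that by (simp add: degree_in_def sum.distrib inner_add_left)
  show "c *\<^sub>R v \<in> ?D" if "v \<in> ?D" "0 \<le> c" for c v
    using that unfolding degree_in_def mem_Collect_eq sum_scale inner_scaleR_left by simp
qed

lemma closed_log_D: "closed (formal_log ` ratios_D)"
proof -
  have *: "formal_log ` ratios_D = {v. (\<Sum>S\<in>UNIV. v $ S) = 0} \<inter> (\<Inter>i. {v. degree_in i v = 0}) \<inter>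
     (\<Inter>M. {v. 0 \<le> v \<bullet> nullity_type M})"
    unfolding formal_log_ratios_D by blast
  show ?thesis
    unfolding * degree_in_def
    by (intro closed_Int closed_INT ballI closed_Collect_eq closed_Collect_le continuous_intros)
qed

section \<open>Pointedness\<close>

text \<open>
  A single 0-1 row has rank 1 on the sets of columns that meet its support and rank 0 elsewhere.
\<close>
lemma nullity_type_indicator_row:
  fixes S :: "'n::finite set"
  shows "nullity_type [\<chi> i. if i \<in> S then 1 else 0] $ T = real (card T) - (if T \<inter> S = {} then 0 else 1)"
proof (induction T rule: finite_induct[OF finite])
  case 1
  show ?case by (simp add: nullity_type_empty)
next
  case (2 j T)
  let ?M = "[\<chi> i. if i \<in> S then 1 else 0] :: (complex ^ 'n) list"
  have row: "(\<Sum>k\<in>UNIV. (if k \<in> S then 1 else 0) * w $ k) = (\<Sum>k\<in>S. w $ k)"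
    for w :: "complex ^ 'n"
    by (rule sum.mono_neutral_cong_right) auto
  have mem: "w \<in> null_space ?M (insert j T) \<longleftrightarrow>
      (\<forall>i. i \<notin> insert j T \<longrightarrow> w $ i = 0) \<and> (\<Sum>k\<in>S. w $ k) = 0" for w
    unfolding mem_null_space by (simp add: row)
  have "pivot_vectors j T \<inter> null_space ?M (insert j T) \<noteq> {} \<longleftrightarrow> j \<notin> S \<or> T \<inter> S \<noteq> {}"
  proof
    assume "pivot_vectors j T \<inter> null_space ?M (insert j T) \<noteq> {}"
    then obtain w :: "complex ^ 'n" where w: "w $ j = 1" "\<forall>i. i \<notin> insert j T \<longrightarrow> w $ i = 0" "(\<Sum>k\<in>S. w $ k) = 0"
      by (auto simp: mem pivot_vectors_def)
    show "j \<notin> S \<or> T \<inter> S \<noteq> {}"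
    proof (rule ccontr)
      assume "\<not> (j \<notin> S \<or> T \<inter> S \<noteq> {})"
      then have "(\<Sum>k\<in>S. w $ k) = (\<Sum>k\<in>{j}. w $ k)"
        by (intro sum.mono_neutral_right) (use w in auto)
      then show False using w by simp
    qed
  next
    assume "j \<notin> S \<or> T \<inter> S \<noteq> {}"
    then consider "j \<notin> S" | l where "j \<in> S" "l \<in> T" "l \<in> S" by blast
    then show "pivot_vectors j T \<inter> null_space ?M (insert j T) \<noteq> {}"
    proof cases
      case 1
      then have "axis j 1 \<in> pivot_vectors j T \<inter> null_space ?M (insert j T)"
        by (auto simp: mem pivot_vectors_def axis_def intro!: sum.neutral)
      then show ?thesis by blast
    next
      case 2
      then have "l \<noteq> j" using \<open>j \<notin> T\<close> by auto
      then have "axis j 1 - axis l 1 \<in> pivot_vectors j T \<inter> null_space ?M (insert j T)"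
        using 2 by (auto simp: mem pivot_vectors_def axis_def sum_subtractf)
      then show ?thesis by blast
    qed
  qed
  then show ?case
    using 2 by (simp add: nullity_type_insert)
qed

text \<open>
  The cardinality part of the nullity pairs to the sum of all degrees, hence to 0; the constant part
  pairs to 0 because the coordinates sum to 0. What is left is the contribution of the sets missing
  the support of the row.
\<close>
lemma inner_nullity_type_indicator_row:
  fixes v :: "real ^ 'n::finite set"
  assumes sum: "(\<Sum>S\<in>UNIV. v $ S) = 0" and deg: "\<And>i. degree_in i v = 0"
  shows "v \<bullet> nullity_type [\<chi> i. if i \<in> - U then 1 else 0] = (\<Sum>T\<in>Pow U. v $ T)"
proof -
  have "(\<Sum>T\<in>UNIV. v $ T * real (card T)) = (\<Sum>T\<in>UNIV. \<Sum>i\<in>UNIV. if i \<in> T then v $ T else 0)"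
    by (simp add: mult.commute flip: sum.inter_filter)
  also have "\<dots> = (\<Sum>i\<in>UNIV. \<Sum>T\<in>UNIV. if i \<in> T then v $ T else 0)"
    by (rule sum.swap)
  also have "\<dots> = (\<Sum>i\<in>UNIV. degree_in i v)"
    by (simp add: degree_in_def flip: sum.inter_filter)
  finally have card: "(\<Sum>T\<in>UNIV. v $ T * real (card T)) = 0"
    by (simp add: deg)
  have "v \<bullet> nullity_type [\<chi> i. if i \<in> - U then 1 else 0]
      = (\<Sum>T\<in>UNIV. v $ T * real (card T) - v $ T + (if T \<in> Pow U then v $ T else 0))"
    unfolding inner_vec_def nullity_type_indicator_row
    by (rule sum.cong) (auto simp: right_diff_distrib)
  also have "\<dots> = (\<Sum>T\<in>Pow U. v $ T)"
    by (simp add: sum.distrib sum_subtractf card sum flip: sum.inter_filter)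
      (simp add: Pow_def)
  finally show ?thesis .
qed

lemma subset_sums_zero_imp_zero:
  fixes v :: "real ^ 'n::finite set"
  assumes "\<And>U. (\<Sum>T\<in>Pow U. v $ T) = 0"
  shows "v = 0"
proof -
  have "v $ U = 0" for U
  proof (induction U rule: finite_psubset_induct[OF finite])
    case (1 U)
    have "(\<Sum>T\<in>Pow U. v $ T) = v $ U + (\<Sum>T\<in>Pow U - {U}. v $ T)"
      by (rule sum.remove) auto
    also have "(\<Sum>T\<in>Pow U - {U}. v $ T) = 0"
      by (rule sum.neutral) (use 1 in auto)
    finally show ?case using assms by simp
  qed
  then show ?thesis by (simp add: vec_eq_iff)
qed

text \<open>
  The functional is the sum of the nullity types of all 0-1 rows. Each of them is nonnegative on the cone, and
  a vector of the cone on which all of them vanish is zero.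
\<close>
lemma log_D_pointed:
  "\<exists>u :: real ^ 'n::finite set. \<forall>v\<in>formal_log ` ratios_D. v \<noteq> 0 \<longrightarrow> 0 < u \<bullet> v"
proof -
  define row :: "'n set \<Rightarrow> (complex ^ 'n) list" where "row U = [\<chi> i. if i \<in> - U then 1 else 0]" for U
  have "0 < (\<Sum>U\<in>UNIV. nullity_type (row U)) \<bullet> v"
    if v: "v \<in> formal_log ` ratios_D" "v \<noteq> 0" for v
  proof -
    have D: "(\<Sum>S\<in>UNIV. v $ S) = 0" "\<And>i. degree_in i v = 0" "\<And>M. 0 \<le> v \<bullet> nullity_type M"
      using v(1) unfolding formal_log_ratios_D by auto
    obtain U where "(\<Sum>T\<in>Pow U. v $ T) \<noteq> 0"
      using subset_sums_zero_imp_zero v(2) by blast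
    then have "v \<bullet> nullity_type (row U) \<noteq> 0"
      using inner_nullity_type_indicator_row[OF D(1,2)] by (simp add: row_def)
    then have "0 < v \<bullet> nullity_type (row U)"
      using D(3)[of "row U"] by linarith
    then have "0 < (\<Sum>U\<in>UNIV. v \<bullet> nullity_type (row U))"
      by (intro sum_pos2[of _ U]) (use D in auto)
    then show ?thesis
      by (subst inner_commute) (simp add: inner_sum_right)
  qed
  then show ?thesis by blast
qed

section \<open>Closed pointed cones and their extreme rays\<close>

text \<open>
  Segments in the cone that cross the ray are rescaled, endpoint by endpoint, to segments in the slice through
  its extreme point \<open>x\<close>, which are trivial. Endpoints at 0 cannot be rescaled and are treated
  separately.
\<close>
lemma extreme_point_imp_extreme_ray:
  fixes C :: "'a::real_inner set"
  assumes cone: "convex_cone C" and pos: "\<And>x. x \<in> C \<Longrightarrow> x \<noteq> 0 \<Longrightarrow> 0 < u \<bullet> x"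
    and x: "x extreme_point_of (C \<inter> {y. u \<bullet> y = 1})"
  shows "extreme_ray_of (conic hull {x}) C"
proof -
  have xC: "x \<in> C" "u \<bullet> x = 1"
    using x by (auto simp: extreme_point_of_def)
  have conicC: "conic C" using cone by (simp add: convex_cone_def)
  have ray: "conic hull {x} = {c *\<^sub>R x | c. 0 \<le> c}"
    by (simp add: conic_hull_explicit)
  have ray_iff: "a \<in> conic hull {x} \<longleftrightarrow> a = (u \<bullet> a) *\<^sub>R x" if "a \<in> C" for a
  proof -
    have "0 \<le> u \<bullet> a" using pos[OF that] by (cases "a = 0") auto
    then show ?thesis by (auto simp: ray xC)
  qed
  have key: "a = (u \<bullet> a) *\<^sub>R x \<and> b = (u \<bullet> b) *\<^sub>R x"
    if a: "a \<in> C" and b: "b \<in> C" and z: "z \<in> conic hull {x}" "z \<in> open_segment a b" for a b z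
  proof -
    obtain s where s: "0 < s" "s < 1" "z = (1 - s) *\<^sub>R a + s *\<^sub>R b"
      using z(2) by (auto simp: in_segment)
    have zC: "z \<in> C"
      using hull_minimal[of "{x}" C conic] xC conicC z(1) by blast
    have zx: "z = (u \<bullet> z) *\<^sub>R x" using z(1) ray_iff[OF zC] by simp
    have uz: "u \<bullet> z = (1 - s) * (u \<bullet> a) + s * (u \<bullet> b)"
      by (simp add: s inner_add_right)
    show ?thesis
    proof (cases "a = 0 \<or> b = 0")
      case True
      then show ?thesis
      proof
        assume "a = 0"
        then have "s *\<^sub>R b = s *\<^sub>R ((u \<bullet> b) *\<^sub>R x)"
          using zx s uz by simp
        then have "b = (u \<bullet> b) *\<^sub>R x" using s(1) unfolding scaleR_cancel_left by simp
        then show ?thesis using \<open>a = 0\<close> by simp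
      next
        assume "b = 0"
        then have "(1 - s) *\<^sub>R a = (1 - s) *\<^sub>R ((u \<bullet> a) *\<^sub>R x)"
          using zx s uz by simp
        then have "a = (u \<bullet> a) *\<^sub>R x" using s(2) unfolding scaleR_cancel_left by simp
        then show ?thesis using \<open>b = 0\<close> by simp
      qed
    next
      case False
      define a' b' where "a' = (1 / (u \<bullet> a)) *\<^sub>R a" and "b' = (1 / (u \<bullet> b)) *\<^sub>R b"
      have p: "0 < u \<bullet> a" "0 < u \<bullet> b" using False pos a b by auto
      have mem: "a' \<in> C \<inter> {y. u \<bullet> y = 1}" "b' \<in> C \<inter> {y. u \<bullet> y = 1}"
        using p a b conicC by (auto simp: a'_def b'_def conic_def)
      have uz0: "0 < u \<bullet> z"
        unfolding uz using p s by (intro add_pos_pos mult_pos_pos) auto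
      \<comment> \<open>The parameter of the point \<open>x\<close> on the rescaled segment, weighted by the heights of the endpoints.\<close>
      define r where "r = s * (u \<bullet> b) / (u \<bullet> z)"
      have r1: "1 - r = (1 - s) * (u \<bullet> a) / (u \<bullet> z)"
        using uz0 uz by (simp add: r_def field_simps)
      have r: "0 < r" "r < 1"
      proof -
        show "0 < r" using p s uz0 by (simp add: r_def)
        have "0 < 1 - r" unfolding r1 using p s uz0 by simp
        then show "r < 1" by simp
      qed
      have "x = (1 / (u \<bullet> z)) *\<^sub>R z"
        using uz0 by (subst zx) simp
      also have "\<dots> = (1 - r) *\<^sub>R a' + r *\<^sub>R b'"
        unfolding r1 using p by (simp add: r_def a'_def b'_def s(3) scaleR_add_right)
      finally have x_eq: "x = (1 - r) *\<^sub>R a' + r *\<^sub>R b'" .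
      have "a' = b'"
      proof (rule ccontr)
        assume "a' \<noteq> b'"
        then have "x \<in> open_segment a' b'"
          using r x_eq by (auto simp: in_segment)
        then show False
          using x mem unfolding extreme_point_of_def by blast
      qed
      then have "a' = x" "b' = x"
        using x_eq by (simp_all flip: scaleR_add_left)
      moreover have "a = (u \<bullet> a) *\<^sub>R a'" "b = (u \<bullet> b) *\<^sub>R b'"
        using p by (simp_all add: a'_def b'_def)
      ultimately show ?thesis
        by simp
    qed
  qed
  have "conic hull {x} face_of C"
    unfolding face_of_def
  proof (intro conjI ballI impI)
    show "conic hull {x} \<subseteq> C"
      using xC conicC by (simp add: hull_minimal)
    show "convex (conic hull {x})"
      by (simp add: convex_conic_hull)
  qed (use key ray_iff in blast)+
  moreover have "x \<noteq> 0" using xC by auto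
  ultimately show ?thesis
    unfolding extreme_ray_of_def by blast
qed

text \<open>
  The slice of the cone at height 1 is compact: it is bounded because the functional has a positive minimum on
  the unit vectors of the cone. The Krein-Milman theorem then reduces the inclusion to extreme points of the
  slice.
\<close>
lemma cone_subset_if_extreme_rays_subset:
  fixes C X :: "'a::euclidean_space set"
  assumes closed: "closed C" and cone: "convex_cone C"
    and pos: "\<And>x. x \<in> C \<Longrightarrow> x \<noteq> 0 \<Longrightarrow> 0 < u \<bullet> x"
    and X: "convex_cone X" and rays: "\<And>R. extreme_ray_of R C \<Longrightarrow> R \<subseteq> X"
  shows "C \<subseteq> X"
proof -
  have conicC: "conic C" and convexC: "convex C" using cone by (auto simp: convex_cone_def)
  have conicX: "conic X" and convexX: "convex X" and X0: "0 \<in> X"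
    using X by (auto simp: convex_cone_def conic_contains_0)
  define K where "K = C \<inter> {y. u \<bullet> y = 1}"
  have "bounded K"
  proof (cases "C \<inter> sphere 0 1 = {}")
    case True
    have "x = 0" if "x \<in> C" for x
    proof (rule ccontr)
      assume "x \<noteq> 0"
      then have "(1 / norm x) *\<^sub>R x \<in> C \<inter> sphere 0 1"
        using that conicC by (auto simp: conic_def)
      then show False using True by blast
    qed
    then have "K \<subseteq> {0}" by (auto simp: K_def)
    then show ?thesis by (meson bounded_insert bounded_empty bounded_subset)
  next
    case False
    have "compact (C \<inter> sphere 0 1)"
      using closed by (simp add: closed_Int_compact)
    moreover have "continuous_on (C \<inter> sphere 0 1) (\<lambda>z. u \<bullet> z)"
      by (intro continuous_intros)
    ultimately obtain y where y: "y \<in> C \<inter> sphere 0 1" "\<And>z. z \<in> C \<inter> sphere 0 1 \<Longrightarrow> u \<bullet> y \<le> u \<bullet> z"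
      using continuous_attains_inf[OF _ False] by blast
    have "y \<noteq> 0" using y(1) by auto
    then have uy: "0 < u \<bullet> y" using pos y by blast
    have "norm x \<le> 1 / (u \<bullet> y)" if "x \<in> K" for x
    proof -
      have xC: "x \<in> C" "u \<bullet> x = 1" "x \<noteq> 0" using that by (auto simp: K_def)
      then have "(1 / norm x) *\<^sub>R x \<in> C \<inter> sphere 0 1"
        using conicC by (auto simp: conic_def)
      from y(2)[OF this] have "u \<bullet> y \<le> 1 / norm x" using xC by simp
      then show ?thesis using uy xC by (simp add: field_simps)
    qed
    then show ?thesis unfolding bounded_iff by blast
  qed
  moreover have "closed K"
    unfolding K_def by (intro closed_Int closed closed_hyperplane)
  ultimately have "compact K" by (simp add: compact_eq_bounded_closed)
  moreover have "convex K"
    unfolding K_def by (intro convex_Int convexC convex_hyperplane)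
  ultimately have "K = convex hull {x. x extreme_point_of K}"
    by (rule Krein_Milman_Minkowski)
  also have "\<dots> \<subseteq> X"
  proof (rule hull_minimal)
    show "{x. x extreme_point_of K} \<subseteq> X"
    proof
      fix x assume "x \<in> {x. x extreme_point_of K}"
      then have "extreme_ray_of (conic hull {x}) C"
        using extreme_point_imp_extreme_ray[OF cone pos] by (simp add: K_def)
      then show "x \<in> X"
        using rays hull_inc[of x "{x}"] by blast
    qed
  qed (rule convexX)
  finally have KX: "K \<subseteq> X" .
  show ?thesis
  proof
    fix x assume x: "x \<in> C"
    show "x \<in> X"
    proof (cases "x = 0")
      case False
      then have ux: "0 < u \<bullet> x" using pos x by blast
      then have "(1 / (u \<bullet> x)) *\<^sub>R x \<in> K"
        using x conicC by (auto simp: K_def conic_def)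
      then have "(u \<bullet> x) *\<^sub>R ((1 / (u \<bullet> x)) *\<^sub>R x) \<in> X"
        using KX conicX ux unfolding conic_def by (meson less_imp_le subsetD)
      then show ?thesis using ux by simp
    qed (simp add: X0)
  qed
qed

section \<open>Bounded ratios and the cone of D\<close>

theorem corollary2:
  shows "(ratios_B :: 'n::finite ratio set) \<subseteq> ratios_D \<and>
    ((\<forall>R. extreme_ray_of R (formal_log ` (ratios_D :: 'n ratio set)) \<longrightarrow>
        (\<exists>\<rho> \<in> (ratios_B :: 'n ratio set). R = conic hull {formal_log \<rho>}))
     \<longrightarrow> (ratios_B :: 'n ratio set) = ratios_D)"
proof (intro conjI impI)
  show sub: "(ratios_B :: 'n ratio set) \<subseteq> ratios_D"
    by (auto simp: ratios_B_def ratios_D_def bounded_ratio_iff homogeneous_ratio_iff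
        bounded_exponents_degree bounded_exponents_nullity)
  assume rays: "\<forall>R. extreme_ray_of R (formal_log ` (ratios_D :: 'n ratio set)) \<longrightarrow>
        (\<exists>\<rho> \<in> (ratios_B :: 'n ratio set). R = conic hull {formal_log \<rho>})"
  obtain u :: "real ^ 'n set" where u: "\<And>v. v \<in> formal_log ` ratios_D \<Longrightarrow> v \<noteq> 0 \<Longrightarrow> 0 < u \<bullet> v"
    using log_D_pointed by blast
  have "formal_log ` (ratios_D :: 'n ratio set) \<subseteq> bounded_exponents"
  proof (rule cone_subset_if_extreme_rays_subset[OF closed_log_D convex_cone_log_D u
        convex_cone_bounded_exponents])
    fix R assume "extreme_ray_of R (formal_log ` (ratios_D :: 'n ratio set))"
    then obtain \<rho> :: "'n ratio" where "\<rho> \<in> ratios_B" "R = conic hull {formal_log \<rho>}"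
      using rays by blast
    moreover have "formal_log \<rho> \<in> bounded_exponents"
      using \<open>\<rho> \<in> ratios_B\<close> by (simp add: ratios_B_def bounded_ratio_iff)
    moreover have "conic (bounded_exponents :: (real ^ 'n set) set)"
      using convex_cone_bounded_exponents unfolding convex_cone_def by blast
    ultimately show "R \<subseteq> bounded_exponents"
      by (simp add: hull_minimal)
  qed
  then have "(ratios_D :: 'n ratio set) \<subseteq> ratios_B"
    by (auto simp: ratios_B_def bounded_ratio_iff ratios_D_def)
  then show "(ratios_B :: 'n ratio set) = ratios_D"
    using sub by blast
qed

end
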